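(* Let $(\mathrm{X},\mu)$ be a metric measure space of exact polynomial growth of degree $q>0$ and let $X_0\subseteq X$ be a bounded set. Set $C:=\frac{3^{q+1}}{3^{q+1}-1}$ and $\Delta:=\max(144q,4)$. Then for all $\varepsilon>0$ small enough there exists $s_1=s_1(X_0,\varepsilon)$ such that, with $K:=\lceil2\log_C\frac{4}{\varepsilon}\rceil$, the following holds. Let $L\geq2\log_C(4/\varepsilon)$ be an arbitrary integer. Assume that $\mathcal{U}$ and $\mathcal{V}$ are centered towers over $X_0$ of height $L+1$ such that $$\mathrm{core}(\mathcal{U}),\mathrm{core}(\mathcal{V})\subseteq X_0,\qquad\mathrm{rad}(\mathcal{U}),\mathrm{rad}(\mathcal{V})\geq s_1$$ and $$U_1(x)\subseteq V_1(x)\subseteq U_2(x)\subseteq V_2(x)\subseteq\dots\subseteq U_{L+1}(x)\subseteq V_{L+1}(x)\quad\text{for all }x\in X_0.$$ Suppose that $$U_i(x)^{(1+\Delta/\varepsilon)}\subseteq V_i(x)\quad\text{for all }x\in X_0,\ i=1,\dots,L+1,$$ and that no ball $V\in\mathcal{V}$ can be $4\varepsilon$-filled by a disjoint subcollection of $\mathcal{U}$. Then $$\mu\left(\bigcup_{U\in\mathcal{U}_1}U\right)\leq\left(1+\frac{\varepsilon}{3^{q+1}}\right)^{-\lfloor L/K\rfloor}\mu\left(\bigcup_{V\in\mathcal{V}_{L+1}}V\right).$$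
   Context: A metric measure space $(\mathrm{X},\mu)$ is a metric space $\mathrm{X}=(X,d)$ with a Borel measure $\mu$ on $X$. $\mathrm{B}(x,r)$ is the closed ball. The measure $\mu$ is strictly positive if $0<\mu(\mathrm{B}(x,r))<\infty$ for all $x\in X$, $r>0$. $(\mathrm{X},\mu)$ with $\mu$ strictly positive is of exact polynomial (volume) growth of degree $q\geq0$ if there is a constant $c_X>0$ with $\lim_{t\to\infty}\frac{\mu(\mathrm{B}(x,t))}{c_Xt^q}=1$ for all $x\in X$. Balls always come with a chosen center and radius. For a ball $W=\mathrm{B}(y,s)$ and $\delta\geq0$, $W^\delta:=\mathrm{B}(y,(1+\delta)s)$. For a collection $\mathcal{C}$ of balls, $\mathrm{rad}(\mathcal{C})$ is the infimum of the radii of its balls and $\mathrm{core}(\mathcal{C})$ is the set of centers of its balls. For a nonempty $W\subseteq X$ and $n\in\mathbb{N}$, a tower $\mathcal{U}$ over $W$ of height $n$ is a finite collection of balls $\mathcal{U}=\{U_i(x):x\in W,\ i=1,\dots,n\}$ indexed by $x\in W$ and $i=1,\dots,n$ ($W$ may be infinite, but the collection of balls is finite) such that $x\in U_i(x)$ for all $x\in W$ and all $i$, and $U_1(x)\subseteq\dots\subseteq U_n(x)$ for all $x\in W$. Its $i$-th level is $\mathcal{U}_i:=\{U_i(x):x\in W\}$. The tower is centered if every $U_i(x)$ is of the form $\mathrm{B}(x,r)$ for some $r\geq0$. The balls of the tower $\mathcal{V}$ are denoted $V_i(x)$. A collection of measurable sets $(I_j)$ $\delta$-fills a measurable set $I$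 if $I_j\subseteq I$ for all $j$ and $\mu(I\setminus\bigcup_jI_j)<\delta\mu(I)$. *)

theory Defs
  imports "HOL-Analysis.Analysis"
begin

definition strictly_positive_measure :: "'a::metric_space measure \<Rightarrow> bool" where
  "strictly_positive_measure M \<longleftrightarrow>
     (\<forall>x r. r > 0 \<longrightarrow> 0 < emeasure M (cball x r) \<and> emeasure M (cball x r) < \<infinity>)"

definition exact_polynomial_growth :: "'a::metric_space measure \<Rightarrow> real \<Rightarrow> bool" where
  "exact_polynomial_growth M q \<longleftrightarrow>
     sets M = sets borel \<and> strictly_positive_measure M \<and> q \<ge> 0 \<and>
     (\<exists>c>0. \<forall>x. ((\<lambda>t. measure M (cball x t) / (c * t powr q)) \<longlongrightarrow> 1) at_top)"

text \<open>
  A ball is a closed ball together with a chosen center and radius; these are in general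
  not determined by the underlying point set.
\<close>

datatype 'a mball = MBall (ball_center: 'a) (ball_radius: real)

definition ball_set :: "'a::metric_space mball \<Rightarrow> 'a set" where
  "ball_set B = cball (ball_center B) (ball_radius B)"

definition enlarge :: "'a mball \<Rightarrow> real \<Rightarrow> 'a mball" where
  "enlarge B \<delta> = MBall (ball_center B) ((1 + \<delta>) * ball_radius B)"

definition rad :: "'a mball set \<Rightarrow> real" where
  "rad \<C> = (INF B\<in>\<C>. ball_radius B)"

definition core :: "'a mball set \<Rightarrow> 'a set" where
  "core \<C> = ball_center ` \<C>"

text \<open>
  A tower is given by its indexing function; \<open>U i x\<close> is the ball $U_i(x)$, and only the
  values for $x \in W$ and $1 \le i \le n$ matter.
\<close>

definition tower_level :: "'a set \<Rightarrow> (nat \<Rightarrow> 'a \<Rightarrow> 'a mball) \<Rightarrow> nat \<Rightarrow> 'a mball set" where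
  "tower_level W U i = U i ` W"

definition tower_balls :: "'a set \<Rightarrow> nat \<Rightarrow> (nat \<Rightarrow> 'a \<Rightarrow> 'a mball) \<Rightarrow> 'a mball set" where
  "tower_balls W n U = (\<Union>i\<in>{1..n}. tower_level W U i)"

text \<open>
  Finiteness is required of the collection of point sets. Requiring it of the collection of
  balls with their centers would force \<open>W\<close> to be finite as soon as the tower is centered.
  Radii of balls in a tower are nonnegative because the balls are nonempty.
\<close>

definition tower :: "'a::metric_space set \<Rightarrow> nat \<Rightarrow> (nat \<Rightarrow> 'a \<Rightarrow> 'a mball) \<Rightarrow> bool" where
  "tower W n U \<longleftrightarrow>
     W \<noteq> {} \<and>
     finite (ball_set ` tower_balls W n U) \<and>
     (\<forall>x\<in>W. \<forall>i\<in>{1..n}. x \<in> ball_set (U i x)) \<and>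
     (\<forall>x\<in>W. \<forall>i\<in>{1..<n}. ball_set (U i x) \<subseteq> ball_set (U (i + 1) x))"

definition centered :: "'a set \<Rightarrow> nat \<Rightarrow> (nat \<Rightarrow> 'a \<Rightarrow> 'a mball) \<Rightarrow> bool" where
  "centered W n U \<longleftrightarrow> (\<forall>x\<in>W. \<forall>i\<in>{1..n}. \<exists>r\<ge>0. U i x = MBall x r)"

definition fills :: "'a measure \<Rightarrow> real \<Rightarrow> 'a set set \<Rightarrow> 'a set \<Rightarrow> bool" where
  "fills M \<delta> \<I> I \<longleftrightarrow>
     \<I> \<subseteq> sets M \<and> I \<in> sets M \<and> (\<forall>J\<in>\<I>. J \<subseteq> I) \<and>
     emeasure M (I - \<Union>\<I>) < ennreal \<delta> * emeasure M I"

end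

(*
  It suffices to gain the factor 1 + eps / 3^(q+1) in the measure of the union of a level of U
  each time K levels are climbed.  Let A be the union of level i and n = i + K - 1.  Among the
  balls of V_n choose a disjoint Vitali family covering a fixed fraction of their union, using
  only "dominating" balls: those that are much larger than every ball of U_n they meet.  If A
  misses the fraction eps / 2 of each chosen ball, the missing parts already give the gain.
  Otherwise some chosen W is almost covered by A, and W can be filled by disjoint balls of U,
  descending through the levels n, ..., i + 1: at each level the part of A in W not yet covered
  is covered by dominating balls inside W that avoid the earlier choices, up to thin shells,
  and the Vitali lemma removes the fraction 1 / 3^(q+1) of the remainder.  After K - 1 levels
  less than 4 eps of W remains, which contradicts the hypothesis.
*)

theory Submission
  imports Defs
begin

section \<open>Vitali selection and dominating balls\<close>

text \<open>If balls about \<open>a\<close> and \<open>b\<close> meet at \<open>p\<close>, this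
  reaches any point \<open>w\<close> of the second ball from the center of the first. The
  containments between meeting balls below rest on it.\<close>

lemma dist_two_centers: "dist a w \<le> dist a p + dist b p + dist b w"
  for a b p w :: "'a::metric_space"
  using dist_triangle[of a w p] dist_triangle[of p w b] by (simp add: dist_commute)

text \<open>Greedy choice: keep a ball of largest radius, discard the balls that meet it, recurse on
  the rest. A discarded ball lies in \<open>enlarge B' 2\<close>, whose radius is three times that
  of the kept ball.\<close>

lemma vitali_finite:
  fixes F :: "'a::metric_space mball set"
  assumes "finite F"
  shows "\<exists>G\<subseteq>F. disjoint_family_on ball_set G \<and>
           (\<forall>B\<in>F. \<exists>B'\<in>G. ball_set B \<subseteq> ball_set (enlarge B' 2))"
  using assms
proof (induction "card F" arbitrary: F rule: less_induct)
  case less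
  show ?case
  proof (cases "F = {}")
    case True
    then show ?thesis by (auto simp: disjoint_family_on_def)
  next
    case False
    obtain B0 where B0: "B0 \<in> F" "\<And>B. B \<in> F \<Longrightarrow> ball_radius B \<le> ball_radius B0"
      using less.prems False Max_in[of "ball_radius ` F"] Max_ge[of "ball_radius ` F"]
      by (metis (no_types, lifting) finite_imageI image_iff image_is_empty)
    \<comment> \<open>The condition \<open>B \<noteq> B0\<close> matters when \<open>B0\<close> has
      negative radius: its point set is then empty, and disjointness alone would keep
      \<open>B0\<close> in \<open>F'\<close>.\<close>
    define F' where "F' = {B\<in>F. ball_set B \<inter> ball_set B0 = {} \<and> B \<noteq> B0}"
    have "F' \<subset> F" using B0(1) by (auto simp: F'_def)
    then obtain G where G: "G \<subseteq> F'" "disjoint_family_on ball_set G"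
      "\<And>B. B \<in> F' \<Longrightarrow> \<exists>B'\<in>G. ball_set B \<subseteq> ball_set (enlarge B' 2)"
      using less.hyps[of F'] less.prems by (metis psubset_card_mono finite_subset psubset_imp_subset)
    have disj: "disjoint_family_on ball_set (insert B0 G)"
      using G(1,2) by (auto simp: disjoint_family_on_def F'_def)
    have "\<exists>B'\<in>insert B0 G. ball_set B \<subseteq> ball_set (enlarge B' 2)" if "B \<in> F" for B
    proof (cases "B \<in> F'")
      case True
      then show ?thesis using G(3) by blast
    next
      case False
      show ?thesis
      proof (cases "ball_set B = {}")
        case True
        then show ?thesis by auto
      next
        case ne: False
        then have "ball_set B \<inter> ball_set B0 \<noteq> {}" using False that by (auto simp: F'_def)
        then obtain p where p: "dist (ball_center B) p \<le> ball_radius B"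
          "dist (ball_center B0) p \<le> ball_radius B0"
          by (auto simp: ball_set_def)
        have "ball_set B \<subseteq> ball_set (enlarge B0 2)"
        proof
          fix z assume "z \<in> ball_set B"
          then have "dist (ball_center B) z \<le> ball_radius B" by (simp add: ball_set_def)
          moreover have "dist (ball_center B0) z \<le> dist (ball_center B0) p + dist (ball_center B) p
              + dist (ball_center B) z"
            by (rule dist_two_centers)
          ultimately show "z \<in> ball_set (enlarge B0 2)"
            using p B0(2)[OF that] by (simp add: ball_set_def enlarge_def)
        qed
        then show ?thesis by blast
      qed
    qed
    then show ?thesis using disj G(1) B0(1) \<open>F' \<subset> F\<close> by (intro exI[of _ "insert B0 G"]) auto
  qed
qed

text \<open>
  Balls are point sets, so \<open>cball x r \<subseteq> cball y s\<close> does not bound \<open>r\<close> in terms of \<open>s\<close> in a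
  general metric space; for large radii volume growth does, which is \<open>radius_le\<close> below.
\<close>

locale regular_balls =
  fixes M :: "'a::metric_space measure" and X0 :: "'a set" and T s1 \<epsilon> \<kappa> :: real
  assumes sets_M: "sets M = sets borel"
    and finite_ball: "\<And>x r. emeasure M (cball x r) < \<infinity>"
    and T: "T \<ge> 1" and s1: "s1 > 0" and \<epsilon>: "\<epsilon> > 0" and \<kappa>: "\<kappa> > 0" "\<kappa> \<le> 1"
    and ball_pos: "\<And>x r. x \<in> X0 \<Longrightarrow> r \<ge> s1 \<Longrightarrow> 0 < measure M (cball x r)"
    and tripling: "\<And>x r. x \<in> X0 \<Longrightarrow> r \<ge> s1 \<Longrightarrow>
      measure M (cball x (3 * r)) \<le> T / 2 * measure M (cball x r)"
    and outer_shell: "\<And>x r. x \<in> X0 \<Longrightarrow> r \<ge> s1 \<Longrightarrow>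
      measure M (cball x ((1 + 2 * \<kappa>) * r)) \<le> (1 + \<epsilon>) * measure M (cball x r)"
    and inner_shell: "\<And>x r. x \<in> X0 \<Longrightarrow> r \<ge> s1 \<Longrightarrow>
      (1 - \<epsilon> / 2) * measure M (cball x r) \<le> measure M (cball x ((1 - 2 * \<kappa>) * r))"
    and radius_le: "\<And>x y r s. x \<in> X0 \<Longrightarrow> y \<in> X0 \<Longrightarrow> r \<ge> s1 \<Longrightarrow> s \<ge> s1 \<Longrightarrow>
      cball x r \<subseteq> cball y s \<Longrightarrow> r \<le> 2 * s"
begin

lemma fmeas_cball: "cball x r \<in> fmeasurable M"
  by (intro fmeasurableI) (use finite_ball sets_M in auto)

lemma fmeas_ball: "ball_set B \<in> fmeasurable M"
  unfolding ball_set_def by (rule fmeas_cball)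

lemma fmeas_UN_balls:
  assumes "finite (ball_set ` F)"
  shows "(\<Union>B\<in>F. ball_set B) \<in> fmeasurable M"
  using fmeasurable.finite_Union[of "ball_set ` F"] assms fmeas_ball by auto

definition admissible :: "'a mball \<Rightarrow> bool" where
  "admissible B \<longleftrightarrow> ball_center B \<in> X0 \<and> s1 \<le> ball_radius B"

text \<open>Tower levels are finite only as families of point sets, so finitely many representatives
  are picked before the Vitali selection. The constant \<open>T / 2\<close> instead of
  \<open>T\<close> leaves a factor of two that the growth arguments spend.\<close>

lemma vitali_measure:
  assumes "finite (ball_set ` F)" "\<And>B. B \<in> F \<Longrightarrow> admissible B"
  obtains G where "G \<subseteq> F" "finite G" "disjoint_family_on ball_set G"
    "measure M (\<Union>B\<in>F. ball_set B) \<le> T / 2 * (\<Sum>B\<in>G. measure M (ball_set B))"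
proof -
  obtain F' where F': "F' \<subseteq> F" "finite F'" "ball_set ` F = ball_set ` F'"
    using assms(1) finite_subset_image[of "ball_set ` F" ball_set F] by blast
  obtain G where G: "G \<subseteq> F'" "disjoint_family_on ball_set G"
    "\<And>B. B \<in> F' \<Longrightarrow> \<exists>B'\<in>G. ball_set B \<subseteq> ball_set (enlarge B' 2)"
    using vitali_finite[OF F'(2)] by blast
  have fG: "finite G" using G(1) F'(2) finite_subset by blast
  have "measure M (\<Union>B\<in>F. ball_set B) \<le> measure M (\<Union>B\<in>G. ball_set (enlarge B 2))"
  proof (rule measure_mono_fmeasurable)
    show "(\<Union>B\<in>F. ball_set B) \<subseteq> (\<Union>B\<in>G. ball_set (enlarge B 2))"
    proof
      fix p assume "p \<in> (\<Union>B\<in>F. ball_set B)"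
      then obtain B where "B \<in> F'" "p \<in> ball_set B" using F'(3) by (metis UN_iff)
      then show "p \<in> (\<Union>B\<in>G. ball_set (enlarge B 2))" using G(3)[of B] by blast
    qed
    show "(\<Union>B\<in>F. ball_set B) \<in> sets M"
      using fmeas_UN_balls[OF assms(1)] by (rule fmeasurableD)
    show "(\<Union>B\<in>G. ball_set (enlarge B 2)) \<in> fmeasurable M"
      using fG fmeas_ball by (intro fmeasurable.finite_UN) auto
  qed
  also have "\<dots> \<le> (\<Sum>B\<in>G. measure M (ball_set (enlarge B 2)))"
    using fG fmeas_ball by (intro measure_UNION_le) (auto intro: fmeasurableD)
  also have "\<dots> \<le> (\<Sum>B\<in>G. T / 2 * measure M (ball_set B))"
  proof (rule sum_mono)
    fix B assume "B \<in> G"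
    then have "admissible B" using G(1) F'(1) assms(2) by blast
    then show "measure M (ball_set (enlarge B 2)) \<le> T / 2 * measure M (ball_set B)"
      using tripling[of "ball_center B" "ball_radius B"]
      by (simp add: admissible_def ball_set_def enlarge_def)
  qed
  finally have "measure M (\<Union>B\<in>F. ball_set B) \<le> T / 2 * (\<Sum>B\<in>G. measure M (ball_set B))"
    by (simp add: sum_distrib_left)
  then show thesis using that G fG F'(1) by blast
qed

section \<open>Domination of small balls by large ones, and thin shells\<close>

definition dominating :: "('a \<Rightarrow> 'a mball) \<Rightarrow> 'a mball \<Rightarrow> bool" where
  "dominating A B \<longleftrightarrow> (\<forall>x\<in>X0. ball_set (A x) \<inter> ball_set B \<noteq> {} \<longrightarrow>
     ball_radius (A x) \<le> \<kappa> * ball_radius B)"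

text \<open>
  A ball meeting an outer ball \<open>B y\<close> while violating domination has an outer ball that
  swallows \<open>B y\<close> and is much larger, so an outer ball maximal for inclusion dominates.
\<close>

lemma dominating_cover:
  assumes cA: "\<And>x. x \<in> X0 \<Longrightarrow> ball_center (A x) = x"
    and cB: "\<And>x. x \<in> X0 \<Longrightarrow> ball_center (B x) = x"
    and rB: "\<And>x. x \<in> X0 \<Longrightarrow> s1 \<le> ball_radius (B x)"
    and fin: "finite (ball_set ` B ` X0)"
    and AB: "\<And>x. x \<in> X0 \<Longrightarrow> 3 * ball_radius (A x) \<le> \<kappa> * ball_radius (B x)"
    and y: "y \<in> X0"
  obtains z where "z \<in> X0" "ball_set (B y) \<subseteq> ball_set (B z)" "dominating A (B z)"
proof -
  obtain m where m: "m \<in> ball_set ` B ` X0" "ball_set (B y) \<subseteq> m"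
    "\<And>m'. m' \<in> ball_set ` B ` X0 \<Longrightarrow> m \<subseteq> m' \<Longrightarrow> m = m'"
  proof -
    have "ball_set (B y) \<in> ball_set ` B ` X0" using y by simp
    from finite_has_maximal2[OF fin this] obtain m where "m \<in> ball_set ` B ` X0"
      "ball_set (B y) \<subseteq> m" "\<forall>m' \<in> ball_set ` B ` X0. m \<subseteq> m' \<longrightarrow> m = m'"
      by blast
    then show ?thesis using that[of m] by blast
  qed
  obtain z where z: "z \<in> X0" "m = ball_set (B z)" using m(1) by blast
  have "ball_radius (A x) \<le> \<kappa> * ball_radius (B z)"
    if x: "x \<in> X0" and meet: "ball_set (A x) \<inter> ball_set (B z) \<noteq> {}" for x
  proof (rule ccontr)
    assume "\<not> ?thesis"
    then have big: "\<kappa> * ball_radius (B z) < ball_radius (A x)" by simp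
    \<comment> \<open>Failure of domination makes \<open>B x\<close> more than three times as large
      as \<open>B z\<close>.\<close>
    then have "\<kappa> * (3 * ball_radius (B z)) < \<kappa> * ball_radius (B x)"
      using AB[OF x] by linarith
    then have big3: "3 * ball_radius (B z) < ball_radius (B x)"
      using \<kappa> by simp
    have "\<kappa> * ball_radius (B x) \<le> 1 * ball_radius (B x)"
      using \<kappa> rB[OF x] s1 by (intro mult_right_mono) auto
    then have A3: "3 * ball_radius (A x) \<le> ball_radius (B x)" using AB[OF x] by linarith
    obtain p where p: "dist x p \<le> ball_radius (A x)" "dist z p \<le> ball_radius (B z)"
      using meet x z by (auto simp: ball_set_def cA cB)
    have "ball_set (B z) \<subseteq> ball_set (B x)"
    proof
      fix w assume "w \<in> ball_set (B z)"
      then have "dist z w \<le> ball_radius (B z)" using z by (simp add: ball_set_def cB)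
      moreover have "dist x w \<le> dist x p + dist z p + dist z w"
        by (rule dist_two_centers)
      ultimately show "w \<in> ball_set (B x)"
        using p A3 big3 x by (simp add: ball_set_def cB)
    qed
    \<comment> \<open>Maximality makes the two point sets equal. Equal sets may have different
      radii, but \<open>radius_le\<close> keeps the ratio at most 2, against the factor 3
      above.\<close>
    then have "ball_set (B x) \<subseteq> ball_set (B z)" using m(3)[of "ball_set (B x)"] x z by auto
    then have "ball_radius (B x) \<le> 2 * ball_radius (B z)"
      using radius_le[of x z] x z rB by (simp add: ball_set_def cB)
    then show False using big3 rB[OF z(1)] s1 by linarith
  qed
  then show thesis using that z m(2) by (auto simp: dominating_def)
qed

text \<open>A ball \<open>A x\<close> that meets \<open>B\<close> has diameter at most
  \<open>2 * \<kappa> * ball_radius B\<close>, so it protrudes from \<open>B\<close> by no more than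
  that.\<close>

lemma dominating_subset_enlarge:
  assumes "dominating A B" "x \<in> X0" "ball_set (A x) \<inter> ball_set B \<noteq> {}"
  shows "ball_set (A x) \<subseteq> ball_set (enlarge B (2 * \<kappa>))"
proof
  fix w assume w: "w \<in> ball_set (A x)"
  obtain p where p: "p \<in> ball_set (A x)" "p \<in> ball_set B" using assms(3) by blast
  have "ball_radius (A x) \<le> \<kappa> * ball_radius B" using assms by (auto simp: dominating_def)
  moreover have "dist (ball_center B) w \<le> dist (ball_center B) p + dist (ball_center (A x)) p
      + dist (ball_center (A x)) w"
    by (rule dist_two_centers)
  ultimately show "w \<in> ball_set (enlarge B (2 * \<kappa>))"
    using w p by (simp add: ball_set_def enlarge_def algebra_simps)
qed

text \<open>A negative parameter makes \<open>enlarge\<close> shrink the ball. A ball that reaches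
  the shrunken copy also meets \<open>B\<close>, hence is too small to get out of
  \<open>B\<close>.\<close>

lemma dominating_subset:
  assumes "dominating A B" "x \<in> X0" "ball_set (A x) \<inter> ball_set (enlarge B (- (2 * \<kappa>))) \<noteq> {}"
    and "ball_radius B \<ge> 0"
  shows "ball_set (A x) \<subseteq> ball_set B"
proof
  fix w assume w: "w \<in> ball_set (A x)"
  obtain p where p: "p \<in> ball_set (A x)" "p \<in> ball_set (enlarge B (- (2 * \<kappa>)))"
    using assms(3) by blast
  have pB: "dist (ball_center B) p + 2 * (\<kappa> * ball_radius B) \<le> ball_radius B"
    using p(2) by (simp add: ball_set_def enlarge_def algebra_simps)
  moreover have "0 \<le> \<kappa> * ball_radius B" using \<kappa> assms(4) by simp
  ultimately have "p \<in> ball_set B" by (simp add: ball_set_def)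
  then have "ball_radius (A x) \<le> \<kappa> * ball_radius B" using assms p by (auto simp: dominating_def)
  moreover have "dist (ball_center B) w \<le> dist (ball_center B) p + dist (ball_center (A x)) p
      + dist (ball_center (A x)) w"
    by (rule dist_two_centers)
  ultimately show "w \<in> ball_set B"
    using w p(1) pB by (simp add: ball_set_def)
qed

lemma measure_outer_shell:
  assumes "admissible B"
  shows "measure M (ball_set (enlarge B (2 * \<kappa>)) - ball_set B) \<le> \<epsilon> * measure M (ball_set B)"
proof -
  have r: "0 \<le> ball_radius B" using assms s1 by (simp add: admissible_def)
  have "ball_radius B \<le> (1 + 2 * \<kappa>) * ball_radius B"
    using r \<kappa> by (simp add: algebra_simps)
  then have "ball_set B \<subseteq> ball_set (enlarge B (2 * \<kappa>))"
    by (auto simp: ball_set_def enlarge_def)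
  then have "measure M (ball_set (enlarge B (2 * \<kappa>)) - ball_set B)
      = measure M (ball_set (enlarge B (2 * \<kappa>))) - measure M (ball_set B)"
    by (intro measurable_measure_Diff fmeas_ball fmeasurableD)
  also have "\<dots> \<le> \<epsilon> * measure M (ball_set B)"
    using outer_shell[of "ball_center B" "ball_radius B"] assms
    by (simp add: admissible_def ball_set_def enlarge_def algebra_simps)
  finally show ?thesis .
qed

lemma measure_inner_shell:
  assumes "admissible B"
  shows "measure M (ball_set B - ball_set (enlarge B (- (2 * \<kappa>)))) \<le> \<epsilon> / 2 * measure M (ball_set B)"
proof -
  have r: "0 \<le> ball_radius B" using assms s1 by (simp add: admissible_def)
  have "(1 + - (2 * \<kappa>)) * ball_radius B \<le> ball_radius B"
    using r \<kappa> by (simp add: algebra_simps)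
  then have "ball_set (enlarge B (- (2 * \<kappa>))) \<subseteq> ball_set B"
    by (auto simp: ball_set_def enlarge_def)
  then have "measure M (ball_set B - ball_set (enlarge B (- (2 * \<kappa>))))
      = measure M (ball_set B) - measure M (ball_set (enlarge B (- (2 * \<kappa>))))"
    by (intro measurable_measure_Diff fmeas_ball fmeasurableD)
  also have "\<dots> \<le> \<epsilon> / 2 * measure M (ball_set B)"
    using inner_shell[of "ball_center B" "ball_radius B"] assms
    by (simp add: admissible_def ball_set_def enlarge_def algebra_simps)
  finally show ?thesis .
qed

end

section \<open>Filling a ball and the growth of levels\<close>

text \<open>Collects the hypotheses on both towers, with \<open>N\<close> for their height. Here
  \<open>6 / \<kappa>\<close> stands for the dilation factor
  \<open>2 + \<Delta> / \<epsilon>\<close>, and \<open>unfillable\<close> is the failure of filling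
  in real-valued form, for finite disjoint families of balls rather than of point sets.\<close>

locale unfillable_towers = regular_balls +
  fixes N :: nat and U V :: "nat \<Rightarrow> 'a \<Rightarrow> 'a mball"
  assumes center_U: "\<And>i x. x \<in> X0 \<Longrightarrow> i \<in> {1..N} \<Longrightarrow> ball_center (U i x) = x"
    and center_V: "\<And>i x. x \<in> X0 \<Longrightarrow> i \<in> {1..N} \<Longrightarrow> ball_center (V i x) = x"
    and radius_U: "\<And>i x. x \<in> X0 \<Longrightarrow> i \<in> {1..N} \<Longrightarrow> s1 \<le> ball_radius (U i x)"
    and radius_V: "\<And>i x. x \<in> X0 \<Longrightarrow> i \<in> {1..N} \<Longrightarrow> s1 \<le> ball_radius (V i x)"
    and finite_U: "\<And>i. i \<in> {1..N} \<Longrightarrow> finite (ball_set ` U i ` X0)"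
    and finite_V: "\<And>i. i \<in> {1..N} \<Longrightarrow> finite (ball_set ` V i ` X0)"
    and U_sub_V: "\<And>i x. x \<in> X0 \<Longrightarrow> i \<in> {1..N} \<Longrightarrow> ball_set (U i x) \<subseteq> ball_set (V i x)"
    and V_sub_U: "\<And>i x. x \<in> X0 \<Longrightarrow> i \<in> {1..<N} \<Longrightarrow> ball_set (V i x) \<subseteq> ball_set (U (i + 1) x)"
    and enlarge_sub: "\<And>i x. x \<in> X0 \<Longrightarrow> i \<in> {1..N} \<Longrightarrow>
      cball x (6 / \<kappa> * ball_radius (U i x)) \<subseteq> ball_set (V i x)"
    and unfillable: "\<And>i x P. x \<in> X0 \<Longrightarrow> i \<in> {1..N} \<Longrightarrow> finite P \<Longrightarrow>
      P \<subseteq> (\<Union>j\<in>{1..N}. U j ` X0) \<Longrightarrow> disjoint_family_on ball_set P \<Longrightarrow>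
      (\<Union>B\<in>P. ball_set B) \<subseteq> ball_set (V i x) \<Longrightarrow>
      4 * \<epsilon> * measure M (ball_set (V i x)) \<le> measure M (ball_set (V i x) - (\<Union>B\<in>P. ball_set B))"
begin

section \<open>Nesting and radius jumps in the two towers\<close>

abbreviation level :: "nat \<Rightarrow> 'a set" where
  "level i \<equiv> \<Union>x\<in>X0. ball_set (U i x)"

lemma admissible_U: "x \<in> X0 \<Longrightarrow> i \<in> {1..N} \<Longrightarrow> admissible (U i x)"
  by (simp add: admissible_def center_U radius_U)

lemma admissible_V: "x \<in> X0 \<Longrightarrow> i \<in> {1..N} \<Longrightarrow> admissible (V i x)"
  by (simp add: admissible_def center_V radius_V)

lemma U_mono:
  assumes "x \<in> X0" "1 \<le> i" "i \<le> j" "j \<le> N"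
  shows "ball_set (U i x) \<subseteq> ball_set (U j x)"
  using assms(3,4)
proof (induction j rule: dec_induct)
  case (step j)
  then show ?case using U_sub_V[of x j] V_sub_U[of x j] assms(1,2) by fastforce
qed auto

text \<open>The dilated copy of \<open>U i x\<close> lies in \<open>V i x\<close>, hence in
  \<open>cball x r\<close>, and \<open>radius_le\<close> turns this inclusion into an inequality of
  radii. The 6 is the 2 of \<open>radius_le\<close> times the 3 required by
  \<open>dominating_cover\<close>.\<close>

lemma radius_jump:
  assumes "x \<in> X0" "i \<in> {1..N}" "s1 \<le> r" "ball_set (V i x) \<subseteq> cball x r"
  shows "3 * ball_radius (U i x) \<le> \<kappa> * r"
proof -
  have r: "s1 \<le> ball_radius (U i x)" using radius_U assms by simp
  have "1 * ball_radius (U i x) \<le> 6 / \<kappa> * ball_radius (U i x)"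
    using \<kappa> r s1 by (intro mult_right_mono) (auto simp: field_simps)
  then have "6 / \<kappa> * ball_radius (U i x) \<le> 2 * r"
    using radius_le[of x x "6 / \<kappa> * ball_radius (U i x)" r] enlarge_sub[OF assms(1,2)] assms r
    by auto
  then show ?thesis using \<kappa> by (simp add: field_simps)
qed

lemma fmeas_level: "i \<in> {1..N} \<Longrightarrow> level i \<in> fmeasurable M"
  using fmeas_UN_balls[of "U i ` X0"] finite_U by simp

lemma dominating_V_cover:
  assumes "n \<in> {1..N}" "y \<in> X0"
  obtains z where "z \<in> X0" "ball_set (V n y) \<subseteq> ball_set (V n z)" "dominating (U n) (V n z)"
proof (rule dominating_cover[where A = "U n" and B = "V n" and y = y])
  show "3 * ball_radius (U n x) \<le> \<kappa> * ball_radius (V n x)" if "x \<in> X0" for x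
    using radius_jump[OF that assms(1)] radius_V that assms(1)
    by (simp add: ball_set_def center_V)
qed (use assms center_U center_V radius_V finite_V that in auto)

text \<open>The radius jump from \<open>U l x\<close> to \<open>V l x\<close> passes on to
  \<open>U (l + 1) x\<close>, which contains \<open>V l x\<close>.\<close>

lemma dominating_U_cover:
  assumes "1 \<le> l" "l < N" "y \<in> X0"
  obtains z where "z \<in> X0" "ball_set (U (l + 1) y) \<subseteq> ball_set (U (l + 1) z)"
    "dominating (U l) (U (l + 1) z)"
proof (rule dominating_cover[where A = "U l" and B = "U (l + 1)" and y = y])
  show "3 * ball_radius (U l x) \<le> \<kappa> * ball_radius (U (l + 1) x)" if "x \<in> X0" for x
    using radius_jump[OF that, of l "ball_radius (U (l + 1) x)"] V_sub_U[OF that, of l]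
      radius_U[OF that, of "l + 1"] assms that
    by (simp add: ball_set_def[of "U (l + 1) x"] ball_set_def[of "U (Suc l) x"] center_U)
qed (use assms center_U radius_U finite_U that in auto)

section \<open>Filling one ball of the outer tower from the top level downwards\<close>

text \<open>
  The partial filling \<open>P\<close> is built from the top level downwards; the remaining levels only
  contain balls that are negligible compared to those of \<open>P\<close> which they meet.
\<close>

definition partial_filling :: "'a set \<Rightarrow> nat \<Rightarrow> 'a mball set \<Rightarrow> bool" where
  "partial_filling W l P \<longleftrightarrow> finite P \<and> P \<subseteq> (\<Union>j\<in>{1..N}. U j ` X0) \<and>
     disjoint_family_on ball_set P \<and> (\<Union>B\<in>P. ball_set B) \<subseteq> W \<and>
     (\<forall>B\<in>P. \<forall>x\<in>X0. ball_set (U l x) \<inter> ball_set B \<noteq> {} \<longrightarrow>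
        ball_set (U l x) \<subseteq> ball_set (enlarge B (2 * \<kappa>)))"

text \<open>Most of what \<open>P\<close> leaves uncovered can be covered by balls of
  \<open>U (l + 1)\<close> that stay inside the ball and avoid \<open>P\<close>. The exceptions
  amount to at most \<open>2 * \<epsilon>\<close> of the ball, which by \<open>unfillable\<close> is
  at most half of the remainder, so Vitali selection captures the fraction \<open>1 / T\<close> of
  the remainder.\<close>

lemma partial_filling_step:
  assumes y: "y \<in> X0" and n: "n \<in> {1..N}" and dom: "dominating (U n) (V n y)"
    and i: "1 \<le> i" and l: "i \<le> l" "l < n"
    and cover: "measure M (ball_set (V n y) - level i) \<le> \<epsilon> / 2 * measure M (ball_set (V n y))"
    and P: "partial_filling (ball_set (V n y)) (l + 1) P"
  obtains P' where "partial_filling (ball_set (V n y)) l P'"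
    "measure M (ball_set (V n y) - (\<Union>B\<in>P'. ball_set B))
       \<le> (1 - 1 / T) * measure M (ball_set (V n y) - (\<Union>B\<in>P. ball_set B))"
proof -
  define W where "W = ball_set (V n y)"
  define W' where "W' = ball_set (enlarge (V n y) (- (2 * \<kappa>)))"
  define PP where "PP = (\<Union>B\<in>P. ball_set B)"
  define E where "E B = ball_set (enlarge B (2 * \<kappa>))" for B :: "'a mball"
  define A where "A = level i"
  \<comment> \<open>\<open>G\<close> is the part that is safe to cover: deep enough in
    \<open>W\<close> that the balls meeting it stay in \<open>W\<close>, and outside the enlarged
    balls of \<open>P\<close>, so that the balls meeting it miss \<open>P\<close>.\<close>
  define G where "G = (W' \<inter> A) - (\<Union>B\<in>P. E B)"
  define Q where "Q = {U (l + 1) x |x. x \<in> X0 \<and> dominating (U l) (U (l + 1) x) \<and>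
    ball_set (U (l + 1) x) \<inter> G \<noteq> {}}"
  have lN: "l + 1 \<in> {1..N}" "l \<in> {1..N}" "i \<in> {1..N}" using i l n by auto
  have finP: "finite P" and subP: "P \<subseteq> (\<Union>j\<in>{1..N}. U j ` X0)"
    and disjP: "disjoint_family_on ball_set P" and PW: "PP \<subseteq> W"
    and domP: "\<And>B x. B \<in> P \<Longrightarrow> x \<in> X0 \<Longrightarrow> ball_set (U (l + 1) x) \<inter> ball_set B \<noteq> {} \<Longrightarrow>
        ball_set (U (l + 1) x) \<subseteq> E B"
    using P by (auto simp: partial_filling_def W_def PP_def E_def)
  have admP: "admissible B" if "B \<in> P" for B
    using subP that admissible_U by blast
  have mW: "W \<in> fmeasurable M" "W' \<in> fmeasurable M" and mE: "\<And>B. E B \<in> fmeasurable M"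
    by (auto simp: W_def W'_def E_def fmeas_ball)
  have mPP: "PP \<in> fmeasurable M"
    unfolding PP_def using finP fmeas_ball by (intro fmeasurable.finite_UN) auto
  have mL: "A \<in> fmeasurable M" unfolding A_def using fmeas_level lN by blast
  have mUE: "(\<Union>B\<in>P. E B) \<in> fmeasurable M" using finP mE by (intro fmeasurable.finite_UN) auto
  have mG: "G \<in> fmeasurable M"
    unfolding G_def by (intro fmeasurable.Diff fmeasurable_Int_fmeasurable mW fmeasurableD mL mUE)
  have finQ: "finite (ball_set ` Q)"
    by (rule finite_subset[OF _ finite_U[OF lN(1)]]) (auto simp: Q_def)
  have QW: "B \<subseteq> W" if "B \<in> ball_set ` Q" for B
  proof -
    obtain x where x: "x \<in> X0" "B = ball_set (U (l + 1) x)" "B \<inter> G \<noteq> {}"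
      using \<open>B \<in> ball_set ` Q\<close> unfolding Q_def by blast
    \<comment> \<open>\<open>V n y\<close> is known to dominate level \<open>n\<close> only, so
      \<open>B\<close> is first placed inside \<open>U n x\<close>, using
      \<open>l + 1 \<le> n\<close>.\<close>
    have BU: "B \<subseteq> ball_set (U n x)" using U_mono[of x "l + 1" n] x n l by auto
    moreover have "ball_set (U n x) \<subseteq> ball_set (V n y)"
    proof (rule dominating_subset[OF dom x(1)])
      show "ball_set (U n x) \<inter> ball_set (enlarge (V n y) (- (2 * \<kappa>))) \<noteq> {}"
        using BU x(3) by (auto simp: G_def W'_def)
      show "0 \<le> ball_radius (V n y)" using radius_V[OF y n] s1 by simp
    qed
    ultimately show ?thesis by (auto simp: W_def)
  qed
  have Qdisj: "B \<inter> PP = {}" if "B \<in> ball_set ` Q" for B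
  proof (rule ccontr)
    assume "B \<inter> PP \<noteq> {}"
    moreover obtain x where x: "x \<in> X0" "B = ball_set (U (l + 1) x)" "B \<inter> G \<noteq> {}"
      using \<open>B \<in> ball_set ` Q\<close> unfolding Q_def by blast
    ultimately obtain B' where B': "B' \<in> P" "B \<inter> ball_set B' \<noteq> {}" by (auto simp: PP_def)
    \<comment> \<open>The invariant at level \<open>l + 1\<close> traps a ball touching
      \<open>P\<close> in an enlarged ball of \<open>P\<close>, where \<open>G\<close> has no
      points.\<close>
    then have "B \<subseteq> E B'" using domP x by simp
    then show False using x(3) B'(1) by (auto simp: G_def)
  qed
  have GQ: "G \<subseteq> (\<Union>B\<in>Q. ball_set B)"
  proof
    fix p assume p: "p \<in> G"
    then obtain x where x: "x \<in> X0" "p \<in> ball_set (U i x)" by (auto simp: G_def A_def)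
    then have "p \<in> ball_set (U (l + 1) x)" using U_mono[of x i "l + 1"] i l lN by auto
    moreover obtain z where "z \<in> X0" "ball_set (U (l + 1) x) \<subseteq> ball_set (U (l + 1) z)"
      "dominating (U l) (U (l + 1) z)"
      using dominating_U_cover[of l x] x lN by auto
    ultimately show "p \<in> (\<Union>B\<in>Q. ball_set B)" using p by (auto simp: Q_def)
  qed
  have admQ: "admissible B" if "B \<in> Q" for B using that admissible_U lN by (auto simp: Q_def)
  obtain R where R: "R \<subseteq> Q" "finite R" "disjoint_family_on ball_set R"
    "measure M (\<Union>B\<in>Q. ball_set B) \<le> T / 2 * (\<Sum>B\<in>R. measure M (ball_set B))"
    using vitali_measure[OF finQ admQ] by blast
  define RR where "RR = (\<Union>B\<in>R. ball_set B)"
  have mRR: "RR \<in> fmeasurable M"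
    unfolding RR_def using R(2) fmeas_ball by (intro fmeasurable.finite_UN) auto
  have RW: "RR \<subseteq> W - PP" using QW Qdisj R(1) by (fastforce simp: RR_def)
  have sumR: "measure M RR = (\<Sum>B\<in>R. measure M (ball_set B))"
    unfolding RR_def using R fmeas_ball
    by (intro measure_UNION') (auto simp: disjoint_family_on_def pairwise_def disjnt_def)
  have sumP: "measure M PP = (\<Sum>B\<in>P. measure M (ball_set B))"
    unfolding PP_def using finP disjP fmeas_ball
    by (intro measure_UNION') (auto simp: disjoint_family_on_def pairwise_def disjnt_def)
  define m where "m = measure M W"
  define w where "w = measure M (W - PP)"
  \<comment> \<open>Unfillability applies to the partial filling itself and keeps the remainder
    large compared with the error terms below.\<close>
  have w4: "4 * \<epsilon> * m \<le> w"
    unfolding m_def w_def W_def PP_def using y n finP subP disjP PW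
    by (intro unfillable) (auto simp: W_def PP_def)
  have "measure M G \<le> T / 2 * measure M RR"
  proof -
    have "measure M G \<le> measure M (\<Union>B\<in>Q. ball_set B)"
      by (intro measure_mono_fmeasurable GQ fmeas_UN_balls finQ fmeasurableD mG)
    then show ?thesis using R(4) sumR by simp
  qed
  moreover have "w \<le> measure M G + 2 * \<epsilon> * m"
  proof -
    \<comment> \<open>Error budget in units of \<open>m\<close>: inner shell of \<open>W\<close> at
      most \<open>\<epsilon> / 2\<close>, points missed by \<open>level i\<close> at most
      \<open>\<epsilon> / 2\<close>, outer shells of the disjoint balls of \<open>P\<close> at most
      \<open>\<epsilon>\<close> together.\<close>
    have "W - PP \<subseteq> G \<union> ((W - W') \<union> ((W - A) \<union> (\<Union>B\<in>P. E B - ball_set B)))" (is "_ \<subseteq> ?S")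
      by (auto simp: G_def PP_def)
    then have "w \<le> measure M ?S"
      unfolding w_def using finP mW mL mG mPP mE fmeas_ball
      by (intro measure_mono_fmeasurable fmeasurable.Un fmeasurable.finite_UN fmeasurable.Diff)
        (auto intro: fmeasurableD)
    also have "\<dots> \<le> measure M G + (measure M (W - W') + (measure M (W - A)
        + measure M (\<Union>B\<in>P. E B - ball_set B)))"
      using finP mW mL mG mE fmeas_ball
      by (intro order_trans[OF measure_Un_le] add_left_mono sets.Un sets.Diff sets.finite_UN)
        (auto intro: fmeasurableD)
    also have "measure M (\<Union>B\<in>P. E B - ball_set B) \<le> (\<Sum>B\<in>P. measure M (E B - ball_set B))"
      using finP mE fmeas_ball by (intro measure_UNION_le) (auto intro: fmeasurableD)
    also have "\<dots> \<le> (\<Sum>B\<in>P. \<epsilon> * measure M (ball_set B))"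
      unfolding E_def by (intro sum_mono measure_outer_shell admP)
    also have "\<dots> = \<epsilon> * measure M PP" by (simp add: sumP sum_distrib_left)
    also have "\<dots> \<le> \<epsilon> * m"
      unfolding m_def using \<epsilon> PW mPP mW
      by (intro mult_left_mono measure_mono_fmeasurable) (auto intro: fmeasurableD)
    also have "measure M (W - W') \<le> \<epsilon> / 2 * m"
      unfolding W_def W'_def m_def by (intro measure_inner_shell admissible_V y n)
    also have "measure M (W - A) \<le> \<epsilon> / 2 * m"
      using cover by (simp add: W_def m_def A_def)
    finally show ?thesis by (simp add: algebra_simps)
  qed
  ultimately have "w / 2 \<le> T / 2 * measure M RR" using w4 by linarith
  then have key: "w / T \<le> measure M RR" using T by (simp add: field_simps)
  have "W - (\<Union>B\<in>P \<union> R. ball_set B) = (W - PP) - RR" by (auto simp: PP_def RR_def)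
  then have "measure M (W - (\<Union>B\<in>P \<union> R. ball_set B)) = w - measure M RR"
    unfolding w_def using RW mW mPP mRR
    by (simp add: measurable_measure_Diff fmeasurable.Diff fmeasurableD)
  also have "\<dots> \<le> (1 - 1 / T) * w" using key by (simp add: algebra_simps)
  finally have meas: "measure M (W - (\<Union>B\<in>P \<union> R. ball_set B)) \<le> (1 - 1 / T) * w" .
  have "partial_filling W l (P \<union> R)"
    unfolding partial_filling_def
  proof (intro conjI ballI impI)
    show "finite (P \<union> R)" using finP R(2) by simp
    show "P \<union> R \<subseteq> (\<Union>j\<in>{1..N}. U j ` X0)" 
    proof -
      have "Q \<subseteq> U (l + 1) ` X0" by (auto simp: Q_def)
      then show ?thesis using subP R(1) lN(1) by blast
    qed
    show "disjoint_family_on ball_set (P \<union> R)"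
      using disjP R(3) RW unfolding disjoint_family_on_def PP_def RR_def by blast
    show "(\<Union>B\<in>P \<union> R. ball_set B) \<subseteq> W" using PW RW by (auto simp: PP_def RR_def)
  next
    fix B x assume B: "B \<in> P \<union> R" and x: "x \<in> X0" and meet: "ball_set (U l x) \<inter> ball_set B \<noteq> {}"
    show "ball_set (U l x) \<subseteq> ball_set (enlarge B (2 * \<kappa>))"
    \<comment> \<open>Old balls keep the invariant because \<open>U l x\<close> lies in
      \<open>U (l + 1) x\<close>; new balls have it because they were chosen dominating over level
      \<open>l\<close>.\<close>
    proof (cases "B \<in> P")
      case True
      have "ball_set (U l x) \<subseteq> ball_set (U (l + 1) x)" using U_mono x lN by auto
      then show ?thesis using domP[OF True x] meet by (auto simp: E_def)
    next
      case False
      then have "dominating (U l) B" using B R(1) by (auto simp: Q_def)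
      then show ?thesis using dominating_subset_enlarge x meet by blast
    qed
  qed
  then show thesis using that meas by (simp add: W_def w_def PP_def)
qed

text \<open>Starting from the empty filling at level \<open>n\<close>, \<open>k\<close> steps lead
  down to level \<open>i\<close> and shrink the remainder geometrically, while
  \<open>unfillable\<close> keeps it above the fraction \<open>4 * \<epsilon>\<close>.\<close>

lemma filling_bound:
  assumes y: "y \<in> X0" and n: "n \<in> {1..N}" and dom: "dominating (U n) (V n y)"
    and i: "1 \<le> i" and n_eq: "n = i + k"
    and cover: "measure M (ball_set (V n y) - level i) \<le> \<epsilon> / 2 * measure M (ball_set (V n y))"
  shows "4 * \<epsilon> \<le> (1 - 1 / T) ^ k"
proof -
  define W where "W = ball_set (V n y)"
  have "\<exists>P. partial_filling W (n - j) P \<and>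
      measure M (W - (\<Union>B\<in>P. ball_set B)) \<le> (1 - 1 / T) ^ j * measure M W"
    if "j \<le> k" for j using that
  proof (induction j)
    case 0
    have "partial_filling W (n - 0) {}" by (auto simp: partial_filling_def disjoint_family_on_def)
    then show ?case by (intro exI[of _ "{}"]) auto
  next
    case (Suc j)
    then obtain P where P: "partial_filling W (n - j) P"
      "measure M (W - (\<Union>B\<in>P. ball_set B)) \<le> (1 - 1 / T) ^ j * measure M W"
      by auto
    have l: "i \<le> n - Suc j" "n - Suc j < n" "n - Suc j + 1 = n - j"
      using Suc.prems n_eq by auto
    obtain P' where P': "partial_filling W (n - Suc j) P'"
      "measure M (W - (\<Union>B\<in>P'. ball_set B)) \<le> (1 - 1 / T) * measure M (W - (\<Union>B\<in>P. ball_set B))"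
      using partial_filling_step[OF y n dom i l(1,2) cover] P(1) unfolding W_def l(3) by blast
    have "(1 - 1 / T) * measure M (W - (\<Union>B\<in>P. ball_set B))
        \<le> (1 - 1 / T) * ((1 - 1 / T) ^ j * measure M W)"
      using P(2) T by (intro mult_left_mono) auto
    then show ?case using P' by (intro exI[of _ P']) (auto simp: mult.assoc)
  qed
  then obtain P where P: "partial_filling W (n - k) P"
    "measure M (W - (\<Union>B\<in>P. ball_set B)) \<le> (1 - 1 / T) ^ k * measure M W"
    by blast
  have "4 * \<epsilon> * measure M W \<le> measure M (W - (\<Union>B\<in>P. ball_set B))"
    unfolding W_def using P(1) y n
    by (intro unfillable) (auto simp: partial_filling_def W_def)
  moreover have "0 < measure M W"
    using ball_pos[OF y, of "ball_radius (V n y)"] radius_V[OF y n] center_V[OF y n]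
    by (simp add: W_def ball_set_def)
  ultimately show ?thesis using P(2) by (meson mult_le_cancel_right_pos order_trans)
qed

text \<open>The union \<open>S\<close> of the dominating balls of \<open>V n\<close> lies between
  \<open>level i\<close> and \<open>level (n + 1)\<close>. Disjoint chosen balls carry the fraction
  \<open>2 / T\<close> of \<open>S\<close>, and by \<open>filling_bound\<close> each of them misses
  \<open>level i\<close> on at least the fraction \<open>\<epsilon> / 2\<close>, so
  \<open>S - level i\<close> has the fraction \<open>\<epsilon> / T\<close> of
  \<open>S\<close>.\<close>

lemma level_growth:
  assumes i: "1 \<le> i" and k: "i + k < N" and small: "(1 - 1 / T) ^ k < 4 * \<epsilon>"
  shows "(1 + \<epsilon> / T) * measure M (level i) \<le> measure M (level (i + k + 1))"
proof -
  define n where "n = i + k"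
  have n: "n \<in> {1..N}" "n \<in> {1..<N}" "n + 1 \<in> {1..N}" "i \<in> {1..N}"
    using i k by (auto simp: n_def)
  define F where "F = {V n x |x. x \<in> X0 \<and> dominating (U n) (V n x)}"
  define S where "S = (\<Union>B\<in>F. ball_set B)"
  have finF: "finite (ball_set ` F)"
    by (rule finite_subset[OF _ finite_V[OF n(1)]]) (auto simp: F_def)
  have admF: "admissible B" if "B \<in> F" for B using that admissible_V n by (auto simp: F_def)
  obtain G where G: "G \<subseteq> F" "finite G" "disjoint_family_on ball_set G"
    "measure M S \<le> T / 2 * (\<Sum>B\<in>G. measure M (ball_set B))"
    using vitali_measure[OF finF admF] unfolding S_def by blast
  have mS: "S \<in> fmeasurable M" unfolding S_def using fmeas_UN_balls[OF finF] .
  have mi: "level i \<in> fmeasurable M" "level (n + 1) \<in> fmeasurable M" using fmeas_level n by auto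
  have iS: "level i \<subseteq> S"
  proof
    fix p assume "p \<in> level i"
    then obtain x where x: "x \<in> X0" "p \<in> ball_set (U i x)" by auto
    then have "p \<in> ball_set (V n x)" using U_mono[of x i n] U_sub_V[of x n] n i by (auto simp: n_def)
    moreover obtain z where "z \<in> X0" "ball_set (V n x) \<subseteq> ball_set (V n z)"
      "dominating (U n) (V n z)"
      using dominating_V_cover[OF n(1) x(1)] by blast
    ultimately show "p \<in> S" by (auto simp: S_def F_def)
  qed
  \<comment> \<open>Passing from \<open>V n\<close> to \<open>U (n + 1)\<close> uses one more level:
    \<open>k\<close> filling steps cost \<open>k + 1\<close> levels.\<close>
  have "S \<subseteq> level (n + 1)" using V_sub_U n by (fastforce simp: S_def F_def)
  then have Sn: "measure M S \<le> measure M (level (n + 1))"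
    using mS mi by (intro measure_mono_fmeasurable) (auto intro: fmeasurableD)
  have bad: "\<epsilon> / 2 * measure M (ball_set B) \<le> measure M (ball_set B - level i)" if B: "B \<in> G" for B
  proof (rule ccontr)
    assume "\<not> ?thesis"
    moreover obtain y where "y \<in> X0" "B = V n y" "dominating (U n) (V n y)"
      using B G(1) by (auto simp: F_def)
    ultimately have "4 * \<epsilon> \<le> (1 - 1 / T) ^ k"
      using n(1) i n_def by (intro filling_bound) auto
    then show False using small by simp
  qed
  have "\<epsilon> / T * measure M (level i) \<le> \<epsilon> / T * measure M S"
    using \<epsilon> T iS mS mi by (intro mult_left_mono measure_mono_fmeasurable) (auto intro: fmeasurableD)
  also have "\<dots> \<le> \<epsilon> / T * (T / 2 * (\<Sum>B\<in>G. measure M (ball_set B)))"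
    using \<epsilon> T G(4) by (intro mult_left_mono) auto
  also have "\<dots> = (\<Sum>B\<in>G. \<epsilon> / 2 * measure M (ball_set B))"
    using T by (simp add: sum_distrib_left)
  also have "\<dots> \<le> (\<Sum>B\<in>G. measure M (ball_set B - level i))" by (intro sum_mono bad)
  also have "\<dots> = measure M (\<Union>B\<in>G. ball_set B - level i)"
    using G mi fmeas_ball
    by (intro measure_UNION'[symmetric])
      (auto simp: disjoint_family_on_def pairwise_def disjnt_def)
  also have "\<dots> \<le> measure M (S - level i)"
  proof (rule measure_mono_fmeasurable)
    show "(\<Union>B\<in>G. ball_set B - level i) \<subseteq> S - level i" using G(1) by (auto simp: S_def)
    show "(\<Union>B\<in>G. ball_set B - level i) \<in> sets M"
      by (rule sets.finite_UN[OF G(2)], rule sets.Diff) (intro fmeasurableD fmeas_ball mi)+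
  qed (intro fmeasurable.Diff mS mi)
  also have "\<dots> = measure M S - measure M (level i)"
    using mS mi iS by (intro measurable_measure_Diff) (auto intro: fmeasurableD)
  finally show ?thesis using Sn by (simp add: algebra_simps n_def)
qed

lemma iterated_level_growth:
  assumes "(1 - 1 / T) ^ k < 4 * \<epsilon>" "1 + j * (k + 1) \<le> N"
  shows "(1 + \<epsilon> / T) ^ j * measure M (level 1) \<le> measure M (level (1 + j * (k + 1)))"
  using assms(2)
proof (induction j)
  case (Suc j)
  define i where "i = 1 + j * (k + 1)"
  have "(1 + \<epsilon> / T) ^ Suc j * measure M (level 1)
      \<le> (1 + \<epsilon> / T) * measure M (level i)"
    using Suc \<epsilon> T unfolding power_Suc mult.assoc i_def by (intro mult_left_mono) auto
  also have "\<dots> \<le> measure M (level (i + k + 1))"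
    using assms(1) Suc.prems by (intro level_growth) (auto simp: i_def)
  finally show ?case by (simp add: i_def algebra_simps)
qed auto

end

section \<open>Consequences of exact polynomial growth\<close>

text \<open>\<open>strictly_positive_measure\<close> speaks of positive radii only, so the ball is
  first enlarged to radius at least 1.\<close>

lemma emeasure_cball_finite:
  assumes "strictly_positive_measure M" "sets M = sets borel"
  shows "emeasure M (cball x r) < \<infinity>"
proof -
  have "emeasure M (cball x r) \<le> emeasure M (cball x (max r 1))"
    using assms(2) by (intro emeasure_mono) auto
  also have "\<dots> < \<infinity>"
    using assms(1) unfolding strictly_positive_measure_def
    by (metis less_max_iff_disj zero_less_one)
  finally show ?thesis .
qed

text \<open>Shifting the radius by \<open>a\<close> changes the normalizing power by the factor
  \<open>(1 + a / t) powr q\<close>, which tends to 1.\<close>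

lemma growth_shift:
  fixes a c q :: real
  assumes "((\<lambda>t. measure M (cball x t) / (c * t powr q)) \<longlongrightarrow> 1) at_top"
  shows "((\<lambda>t. measure M (cball x (t + a)) / (c * t powr q)) \<longlongrightarrow> 1) at_top"
proof -
  have "((\<lambda>t. measure M (cball x (t + a)) / (c * (t + a) powr q)) \<longlongrightarrow> 1) at_top"
    using filterlim_compose[OF assms filterlim_tendsto_add_at_top[OF tendsto_const[of a] filterlim_ident]]
    by (simp add: add.commute)
  moreover have "((\<lambda>t::real. a / t) \<longlongrightarrow> 0) at_top"
    by (rule tendsto_divide_0[OF tendsto_const filterlim_at_top_imp_at_infinity[OF filterlim_ident]])
  then have "((\<lambda>t. (1 + a / t) powr q) \<longlongrightarrow> (1 + 0) powr q) at_top"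
    by (intro tendsto_intros) auto
  ultimately have "((\<lambda>t. measure M (cball x (t + a)) / (c * (t + a) powr q) * (1 + a / t) powr q)
      \<longlongrightarrow> 1 * (1 + 0) powr q) at_top"
    by (rule tendsto_mult)
  moreover have "eventually (\<lambda>t. measure M (cball x (t + a)) / (c * (t + a) powr q) * (1 + a / t) powr q
      = measure M (cball x (t + a)) / (c * t powr q)) at_top"
    using eventually_gt_at_top[of "\<bar>a\<bar>"]
  proof eventually_elim
    case (elim t)
    then have t: "t > 0" "1 + a / t > 0" "t + a > 0" by (auto simp: field_simps)
    have "t * (1 + a / t) = t + a" using t by (simp add: distrib_left)
    then have "(t + a) powr q = (t * (1 + a / t)) powr q" by simp
    also have "\<dots> = t powr q * (1 + a / t) powr q" using t by (simp add: powr_mult)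
    finally show ?case using t by simp
  qed
  ultimately show ?thesis by (simp cong: filterlim_cong)
qed

text \<open>The limit is given pointwise in \<open>x\<close>. On a bounded set it becomes uniform
  because \<open>cball x t\<close> lies between the balls of radii \<open>t - R\<close> and
  \<open>t + R\<close> about one fixed point.\<close>

lemma uniform_growth:
  fixes M :: "'a::metric_space measure"
  assumes "exact_polynomial_growth M q" "bounded X0" "\<eta> > 0"
  obtains c s0 where "c > 0" "s0 > 0"
    "\<And>x t. x \<in> X0 \<Longrightarrow> s0 \<le> t \<Longrightarrow> (1 - \<eta>) * (c * t powr q) \<le> measure M (cball x t)"
    "\<And>x t. x \<in> X0 \<Longrightarrow> s0 \<le> t \<Longrightarrow> measure M (cball x t) \<le> (1 + \<eta>) * (c * t powr q)"
proof -
  from assms(1) obtain c where c: "c > 0"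
    "\<And>x. ((\<lambda>t. measure M (cball x t) / (c * t powr q)) \<longlongrightarrow> 1) at_top"
    and M: "sets M = sets borel" "strictly_positive_measure M"
    by (auto simp: exact_polynomial_growth_def)
  \<comment> \<open>Any base point will do; it need not lie in \<open>X0\<close>, which may be
    empty.\<close>
  define x0 :: 'a where "x0 = undefined"
  obtain R where R: "\<And>x. x \<in> X0 \<Longrightarrow> dist x0 x \<le> R"
    using assms(2) by (auto simp: bounded_any_center[where a = x0])
  have "eventually (\<lambda>t. measure M (cball x0 (t + R)) / (c * t powr q) < 1 + \<eta>) at_top"
    using order_tendstoD(2)[OF growth_shift[OF c(2)[of x0], of R]] assms(3) by simp
  moreover have "eventually (\<lambda>t. 1 - \<eta> < measure M (cball x0 (t + - R)) / (c * t powr q)) at_top"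
    using order_tendstoD(1)[OF growth_shift[OF c(2)[of x0], of "- R"]] assms(3) by simp
  \<comment> \<open>Carried along so that the instance \<open>t = s0\<close> yields
    \<open>s0 > 0\<close>.\<close>
  moreover have "eventually (\<lambda>t::real. t > 0) at_top" by (rule eventually_gt_at_top)
  ultimately have "eventually (\<lambda>t. measure M (cball x0 (t + R)) / (c * t powr q) < 1 + \<eta> \<and>
      1 - \<eta> < measure M (cball x0 (t + - R)) / (c * t powr q) \<and> t > 0) at_top"
    by eventually_elim auto
  then obtain s0 where s0: "\<And>t. s0 \<le> t \<Longrightarrow> measure M (cball x0 (t + R)) / (c * t powr q) < 1 + \<eta> \<and>
      1 - \<eta> < measure M (cball x0 (t + - R)) / (c * t powr q) \<and> t > 0"
    by (auto simp: eventually_at_top_linorder)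
  have mono: "measure M (cball x r) \<le> measure M (cball y s)" if "cball x r \<subseteq> cball y s" for x y r s
    using that emeasure_cball_finite[OF M(2,1)] M(1)
    by (intro measure_mono_fmeasurable fmeasurableI) auto
  show thesis
  proof
    show "c > 0" "s0 > 0" using c s0[of s0] by auto
  next
    fix x t assume x: "x \<in> X0" and t: "s0 \<le> t"
    have pos: "c * t powr q > 0" using c s0[OF t] by simp
    have "cball x0 (t + - R) \<subseteq> cball x t"
    proof
      fix y assume "y \<in> cball x0 (t + - R)"
      then show "y \<in> cball x t"
        using R[OF x] dist_triangle[of x y x0] by (simp add: dist_commute)
    qed
    from mono[OF this] show "(1 - \<eta>) * (c * t powr q) \<le> measure M (cball x t)"
      using s0[OF t] pos by (auto simp: pos_less_divide_eq)
    have "cball x t \<subseteq> cball x0 (t + R)"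
    proof
      fix y assume "y \<in> cball x t"
      then show "y \<in> cball x0 (t + R)"
        using R[OF x] dist_triangle[of x0 y x] by simp
    qed
    from mono[OF this] show "measure M (cball x t) \<le> (1 + \<eta>) * (c * t powr q)"
      using s0[OF t] pos by (auto simp: pos_divide_less_eq)
  qed
qed

section \<open>Elementary power estimates and the regularity of large balls\<close>

lemma one_minus_powr_lower:
  fixes x q :: real
  assumes "0 \<le> x" "x \<le> 1 / 2" "0 \<le> q"
  shows "1 - 2 * x * q \<le> (1 - x) powr q"
proof -
  have "- x - 2 * x\<^sup>2 \<le> ln (1 - x)" by (rule ln_one_minus_pos_lower_bound[OF assms(1,2)])
  moreover have "x * x \<le> x * (1 / 2)" using assms by (intro mult_left_mono) auto
  ultimately have "- (2 * x) \<le> ln (1 - x)" by (simp add: power2_eq_square)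
  then have "q * - (2 * x) \<le> q * ln (1 - x)" using assms(3) by (rule mult_left_mono)
  then have "1 - 2 * x * q \<le> 1 + q * ln (1 - x)" by (simp add: algebra_simps)
  also have "\<dots> \<le> exp (q * ln (1 - x))" by (rule exp_ge_add_one_self)
  also have "\<dots> = (1 - x) powr q" using assms by (simp add: powr_def)
  finally show ?thesis .
qed

text \<open>Like \<open>one_minus_powr_lower\<close>, a substitute for Bernoulli's inequality, whose
  direction depends on whether \<open>q\<close> is below 1; the extra factor 2 makes it valid on
  both sides.\<close>

lemma one_plus_powr_upper:
  fixes x q :: real
  assumes "0 \<le> x" "0 \<le> q" "x * q \<le> 1 / 2"
  shows "(1 + x) powr q \<le> 1 + 2 * (x * q)"
proof -
  have "(1 + x) powr q = exp (q * ln (1 + x))" using assms by (simp add: powr_def)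
  also have "\<dots> \<le> exp (x * q)"
    using mult_left_mono[OF ln_add_one_self_le_self[OF assms(1)] assms(2)] by (simp add: mult.commute)
  also have "\<dots> \<le> 1 + 2 * (x * q)"
    using exp_bound_lemma[of "x * q"] assms by simp
  finally show ?thesis .
qed

text \<open>Large balls about \<open>X0\<close> have measure \<open>c * t powr q\<close> up to
  factors \<open>1 + \<eta>\<close> and \<open>1 - \<eta>\<close>, so the locale assumptions reduce
  to comparing powers. As \<open>\<kappa> * q \<le> \<epsilon> / 24\<close>, the powers of
  \<open>1 + 2 * \<kappa>\<close> and \<open>1 - 2 * \<kappa>\<close> differ from 1 by at most
  \<open>\<epsilon> / 6\<close>.\<close>

lemma regular_balls_exists:
  fixes M :: "'a::metric_space measure"
  assumes growth: "exact_polynomial_growth M q" and q: "q > 0" and X0: "bounded X0"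
    and \<epsilon>: "0 < \<epsilon>" "\<epsilon> < 1 / 10" and \<kappa>: "0 < \<kappa>" "\<kappa> \<le> 1 / 4" "\<kappa> * q \<le> \<epsilon> / 24"
  obtains s1 where "regular_balls M X0 (3 powr (q + 1)) s1 \<epsilon> \<kappa>"
proof -
  define Q where "Q = (2::real) powr q"
  have Q: "Q > 1" using q by (simp add: Q_def)
  \<comment> \<open>The second bound makes \<open>(1 + \<eta>) / (1 - \<eta>)\<close> at most \<open>2 powr q\<close>, hence \<open>radius_le\<close>.\<close>
  define \<eta> where "\<eta> = min (\<epsilon> / 24) ((Q - 1) / (Q + 1))"
  have \<eta>: "0 < \<eta>" "\<eta> \<le> \<epsilon> / 24" and "\<eta> \<le> (Q - 1) / (Q + 1)"
    using \<epsilon> Q unfolding \<eta>_def by (simp, intro min.cobounded1, intro min.cobounded2)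
  then have \<eta>Q: "1 + \<eta> \<le> Q * (1 - \<eta>)" using Q by (simp add: field_simps)
  obtain c s0 where c: "c > 0" and s0: "s0 > 0"
    and lower: "\<And>x t. x \<in> X0 \<Longrightarrow> s0 \<le> t \<Longrightarrow> (1 - \<eta>) * (c * t powr q) \<le> measure M (cball x t)"
    and upper: "\<And>x t. x \<in> X0 \<Longrightarrow> s0 \<le> t \<Longrightarrow> measure M (cball x t) \<le> (1 + \<eta>) * (c * t powr q)"
    using uniform_growth[OF growth X0 \<eta>(1)] by blast
  have M: "sets M = sets borel" "strictly_positive_measure M"
    using growth by (auto simp: exact_polynomial_growth_def)
  have scale: "measure M (cball x (k * r)) \<le> L * measure M (cball x r)"
    if "x \<in> X0" "2 * s0 \<le> r" "1 \<le> k" "0 \<le> L" "(1 + \<eta>) * k powr q \<le> L * (1 - \<eta>)" for x r k L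
  proof -
    have "1 * r \<le> k * r" using that s0 by (intro mult_right_mono) auto
    then have "s0 \<le> k * r" using that s0 by linarith
    then have "measure M (cball x (k * r)) \<le> (1 + \<eta>) * (c * (k * r) powr q)"
      using that by (intro upper) auto
    also have "\<dots> = ((1 + \<eta>) * k powr q) * (c * r powr q)"
      using that s0 by (simp add: powr_mult)
    also have "\<dots> \<le> (L * (1 - \<eta>)) * (c * r powr q)"
      using that c by (intro mult_right_mono) auto
    also have "\<dots> \<le> L * measure M (cball x r)"
      using lower[of x r] that s0 by (auto simp: mult.assoc intro: mult_left_mono)
    finally show ?thesis .
  qed
  \<comment> \<open>The threshold is \<open>2 * s0\<close> because the shrunken radius
    \<open>(1 - 2 * \<kappa>) * r\<close> is at least \<open>r / 2\<close> and must still be at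
    least \<open>s0\<close>.\<close>
  have "regular_balls M X0 (3 powr (q + 1)) (2 * s0) \<epsilon> \<kappa>"
  proof
    show "sets M = sets borel" by fact
    show "emeasure M (cball x r) < \<infinity>" for x r by (rule emeasure_cball_finite[OF M(2,1)])
    show "1 \<le> (3::real) powr (q + 1)" using q by (intro ge_one_powr_ge_zero) auto
    show "0 < 2 * s0" using s0 by simp
    show "0 < \<epsilon>" "0 < \<kappa>" "\<kappa> \<le> 1" using \<epsilon> \<kappa> by auto
  next
    fix x r assume x: "x \<in> X0" and r: "2 * s0 \<le> r"
    have X: "0 < c * r powr q" using c r s0 by simp
    have "0 < 1 - \<eta>" using \<eta> \<epsilon> by simp
    then have "0 < (1 - \<eta>) * (c * r powr q)" using X by (rule mult_pos_pos)
    then show "0 < measure M (cball x r)" using lower[OF x, of r] r s0 by simp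
    \<comment> \<open>Here \<open>T / 2\<close> equals \<open>3 / 2 * 3 powr q\<close>; the factor
      \<open>3 / 2\<close> absorbs the error from \<open>\<eta>\<close>.\<close>
    have "(1 + \<eta>) * 3 powr q \<le> (3 / 2 * (1 - \<eta>)) * 3 powr q"
      using \<eta> \<epsilon> by (intro mult_right_mono) auto
    then show "measure M (cball x (3 * r)) \<le> 3 powr (q + 1) / 2 * measure M (cball x r)"
      using x r by (intro scale) (auto simp: powr_add)
    show "measure M (cball x ((1 + 2 * \<kappa>) * r)) \<le> (1 + \<epsilon>) * measure M (cball x r)"
    proof (rule scale[OF x r])
      have "(1 + 2 * \<kappa>) powr q \<le> 1 + 2 * ((2 * \<kappa>) * q)"
        using \<epsilon> \<kappa> q by (intro one_plus_powr_upper) auto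
      also have "\<dots> \<le> 1 + \<epsilon> / 6" using \<kappa> by simp
      finally have "(1 + \<eta>) * (1 + 2 * \<kappa>) powr q \<le> (1 + \<epsilon> / 24) * (1 + \<epsilon> / 6)"
        using \<eta> \<epsilon> by (intro mult_mono) auto
      also have "\<dots> \<le> (1 + \<epsilon>) * (1 - \<epsilon> / 24)"
      proof -
        have "(1 + \<epsilon>) * (1 - \<epsilon> / 24) - (1 + \<epsilon> / 24) * (1 + \<epsilon> / 6)
            = 3 / 4 * \<epsilon> - 7 / 144 * (\<epsilon> * \<epsilon>)"
          by (simp add: field_simps)
        moreover have "\<epsilon> * \<epsilon> \<le> \<epsilon> * 1" using \<epsilon> by (intro mult_left_mono) auto
        ultimately show ?thesis using \<epsilon> by linarith
      qed
      also have "\<dots> \<le> (1 + \<epsilon>) * (1 - \<eta>)" using \<eta> \<epsilon> by (intro mult_left_mono) auto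
      finally show "(1 + \<eta>) * (1 + 2 * \<kappa>) powr q \<le> (1 + \<epsilon>) * (1 - \<eta>)" .
    qed (use \<epsilon> \<kappa> in auto)
    show "(1 - \<epsilon> / 2) * measure M (cball x r) \<le> measure M (cball x ((1 - 2 * \<kappa>) * r))"
    proof -
      have "(1 / 2) * r \<le> (1 - 2 * \<kappa>) * r" using r s0 \<kappa> by (intro mult_right_mono) auto
      then have r': "s0 \<le> (1 - 2 * \<kappa>) * r" using r by simp
      have "(1 - \<epsilon> / 2) * measure M (cball x r) \<le> (1 - \<epsilon> / 2) * ((1 + \<eta>) * (c * r powr q))"
        using upper[OF x, of r] r s0 \<epsilon> by (intro mult_left_mono) auto
      also have "\<dots> \<le> (1 - \<epsilon> / 2) * ((1 + \<epsilon> / 24) * (c * r powr q))"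
        using \<eta> \<epsilon> X by (intro mult_left_mono mult_right_mono) auto
      also have "\<dots> = ((1 - \<epsilon> / 2) * (1 + \<epsilon> / 24)) * (c * r powr q)" by simp
      also have "\<dots> \<le> ((1 - \<epsilon> / 24) * (1 - \<epsilon> / 6)) * (c * r powr q)"
      proof (rule mult_right_mono)
        have "(1 - \<epsilon> / 24) * (1 - \<epsilon> / 6) - (1 - \<epsilon> / 2) * (1 + \<epsilon> / 24)
            = \<epsilon> / 4 + \<epsilon> * \<epsilon> / 36"
          by (simp add: field_simps)
        moreover have "0 < \<epsilon> * \<epsilon>" using \<epsilon> by simp
        ultimately show "(1 - \<epsilon> / 2) * (1 + \<epsilon> / 24) \<le> (1 - \<epsilon> / 24) * (1 - \<epsilon> / 6)"
          using \<epsilon> by linarith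
      qed (use X in simp)
      also have "\<dots> \<le> ((1 - \<eta>) * (1 - 2 * \<kappa>) powr q) * (c * r powr q)"
      proof (intro mult_right_mono mult_mono)
        have "1 - 2 * (2 * \<kappa>) * q \<le> (1 - 2 * \<kappa>) powr q"
          using \<kappa> q by (intro one_minus_powr_lower) auto
        then show "1 - \<epsilon> / 6 \<le> (1 - 2 * \<kappa>) powr q" using \<kappa>(3) by simp
      qed (use \<eta> \<epsilon> X in auto)
      also have "\<dots> = (1 - \<eta>) * (c * ((1 - 2 * \<kappa>) * r) powr q)"
        using \<kappa> r s0 by (simp add: powr_mult)
      also have "\<dots> \<le> measure M (cball x ((1 - 2 * \<kappa>) * r))" by (rule lower[OF x r'])
      finally show ?thesis .
    qed
  next
    fix x y r s
    assume xy: "x \<in> X0" "y \<in> X0" and r: "2 * s0 \<le> r" and s: "2 * s0 \<le> s"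
      and sub: "cball x r \<subseteq> cball y s"
    have "(1 - \<eta>) * (c * r powr q) \<le> measure M (cball x r)" using r s0 by (intro lower xy) auto
    also have "\<dots> \<le> measure M (cball y s)"
      using sub emeasure_cball_finite[OF M(2,1)] M(1)
      by (intro measure_mono_fmeasurable fmeasurableI) auto
    also have "\<dots> \<le> (1 + \<eta>) * (c * s powr q)" using s s0 by (intro upper xy) auto
    also have "\<dots> \<le> (Q * (1 - \<eta>)) * (c * s powr q)" using \<eta>Q c by (intro mult_right_mono) auto
    also have "\<dots> = (1 - \<eta>) * (c * (2 * s) powr q)" using s s0 by (simp add: Q_def powr_mult)
    finally have "(1 - \<eta>) * (c * r powr q) \<le> (1 - \<eta>) * (c * (2 * s) powr q)" .
    moreover have "1 - \<eta> > 0" using \<eta> \<epsilon> by simp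
    ultimately have "r powr q \<le> (2 * s) powr q" using c by simp
    then show "r \<le> 2 * s" using powr_less_mono2[of q "2 * s" r] q s s0 by force
  qed
  then show thesis by (rule that)
qed

section \<open>From the hypotheses of the theorem to the locale assumptions\<close>

lemma centered_radius_bounds:
  assumes "centered W n U" "rad (tower_balls W n U) \<ge> s" "x \<in> W" "i \<in> {1..n}"
  shows "ball_center (U i x) = x" "s \<le> ball_radius (U i x)"
proof -
  \<comment> \<open>An infimum of reals bounds its members only if the set is bounded below;
    centeredness supplies the bound 0.\<close>
  have "bdd_below (ball_radius ` tower_balls W n U)"
    using assms(1) by (fastforce simp: centered_def tower_balls_def tower_level_def intro: bdd_belowI[of _ 0])
  moreover have "U i x \<in> tower_balls W n U"
    using assms by (auto simp: tower_balls_def tower_level_def)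
  ultimately have "rad (tower_balls W n U) \<le> ball_radius (U i x)"
    unfolding rad_def by (rule cINF_lower)
  then show "s \<le> ball_radius (U i x)" using assms(2) by simp
  obtain r where "U i x = MBall x r" using assms(1,3,4) unfolding centered_def by blast
  then show "ball_center (U i x) = x" by simp
qed

text \<open>Since \<open>1 - 1 / T\<close> is the inverse of \<open>C\<close>, a lower bound on
  \<open>C ^ k\<close> is wanted. The assumption gives \<open>C ^ (k + 1)\<close> at least the
  square of \<open>4 / \<epsilon>\<close>, and the missing factor costs only
  \<open>C \<le> 3 / 2\<close>.\<close>

lemma remainder_power_bound:
  fixes C T \<epsilon> :: real
  assumes C: "C = T / (T - 1)" and T: "T \<ge> 3" and \<epsilon>: "0 < \<epsilon>" "\<epsilon> < 1"
    and k: "2 * log C (4 / \<epsilon>) \<le> real (k + 1)"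
  shows "(1 - 1 / T) ^ k < 4 * \<epsilon>"
proof -
  have C1: "C > 1" "C \<le> 3 / 2" using T by (auto simp: C field_simps)
  have inv: "1 - 1 / T = inverse C" using T by (simp add: C field_simps)
  have "(4 / \<epsilon>)\<^sup>2 = C powr (2 * log C (4 / \<epsilon>))"
    using C1 \<epsilon> by (simp add: powr_powr[symmetric] mult.commute[of 2])
  also have "\<dots> \<le> C powr real (k + 1)" using C1 k by (intro powr_mono) auto
  also have "\<dots> = C ^ (k + 1)" using C1 by (subst powr_realpow) auto
  finally have "(4 / \<epsilon>)\<^sup>2 \<le> C * C ^ k" by simp
  also have "\<dots> \<le> 3 / 2 * C ^ k" using C1 by (intro mult_right_mono) auto
  finally have "32 / 3 \<le> \<epsilon>\<^sup>2 * C ^ k" using \<epsilon> by (simp add: field_simps power2_eq_square)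
  also have "\<epsilon>\<^sup>2 * C ^ k \<le> \<epsilon> * C ^ k"
    using \<epsilon> C1 mult_left_mono[of \<epsilon> 1 \<epsilon>] by (intro mult_right_mono) (auto simp: power2_eq_square)
  finally have "1 < 4 * \<epsilon> * C ^ k" by simp
  then show ?thesis using C1 unfolding inv by (simp add: field_simps)
qed

theorem theorem3p8:
  fixes M :: "'a::metric_space measure" and q :: real and X0 :: "'a set"
    and C \<Delta> :: real
  assumes "exact_polynomial_growth M q" and "q > 0" and "bounded X0"
    and "C = 3 powr (q + 1) / (3 powr (q + 1) - 1)"
    and "\<Delta> = max (144 * q) 4"
  shows "\<exists>\<epsilon>0>0. \<forall>\<epsilon>::real. 0 < \<epsilon> \<and> \<epsilon> < \<epsilon>0 \<longrightarrow>
    (\<exists>s1::real. \<forall>(K::int) (L::nat) (U :: nat \<Rightarrow> 'a \<Rightarrow> 'a mball) (V :: nat \<Rightarrow> 'a \<Rightarrow> 'a mball).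
       K = \<lceil>2 * log C (4 / \<epsilon>)\<rceil> \<longrightarrow>
       real L \<ge> 2 * log C (4 / \<epsilon>) \<longrightarrow>
       tower X0 (L + 1) U \<and> centered X0 (L + 1) U \<longrightarrow>
       tower X0 (L + 1) V \<and> centered X0 (L + 1) V \<longrightarrow>
       core (tower_balls X0 (L + 1) U) \<subseteq> X0 \<and> core (tower_balls X0 (L + 1) V) \<subseteq> X0 \<longrightarrow>
       rad (tower_balls X0 (L + 1) U) \<ge> s1 \<and> rad (tower_balls X0 (L + 1) V) \<ge> s1 \<longrightarrow>
       (\<forall>x\<in>X0. (\<forall>i\<in>{1..L + 1}. ball_set (U i x) \<subseteq> ball_set (V i x)) \<and>
                (\<forall>i\<in>{1..L}. ball_set (V i x) \<subseteq> ball_set (U (i + 1) x))) \<longrightarrow>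
       (\<forall>x\<in>X0. \<forall>i\<in>{1..L + 1}.
          ball_set (enlarge (U i x) (1 + \<Delta> / \<epsilon>)) \<subseteq> ball_set (V i x)) \<longrightarrow>
       (\<forall>B\<in>tower_balls X0 (L + 1) V.
          \<not> (\<exists>\<D>. \<D> \<subseteq> ball_set ` tower_balls X0 (L + 1) U \<and> disjoint \<D> \<and>
                 fills M (4 * \<epsilon>) \<D> (ball_set B))) \<longrightarrow>
       emeasure M (\<Union>B\<in>tower_level X0 U 1. ball_set B)
         \<le> ennreal ((1 + \<epsilon> / 3 powr (q + 1)) powi (- \<lfloor>real L / real_of_int K\<rfloor>))
            * emeasure M (\<Union>B\<in>tower_level X0 V (L + 1). ball_set B))"
proof -
  define T where "T = (3::real) powr (q + 1)"
  have "(3::real) powr 1 \<le> 3 powr (q + 1)" using assms(2) by (intro powr_mono) auto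
  then have T3: "T \<ge> 3" by (simp add: T_def)
  have C: "C = T / (T - 1)" using assms(4) by (simp add: T_def)
  have \<Delta>: "\<Delta> \<ge> 4" "\<Delta> \<ge> 144 * q" using assms(5) by auto
  show ?thesis
  proof (rule exI[of _ "1 / 10"], intro conjI allI impI)
    show "(0::real) < 1 / 10" by simp
    fix \<epsilon> :: real assume "0 < \<epsilon> \<and> \<epsilon> < 1 / 10"
    then have eps: "0 < \<epsilon>" "\<epsilon> < 1 / 10" by auto
    \<comment> \<open>\<open>6 / \<kappa>\<close> is the factor by which \<open>enlarge\<close> scales the radius in the hypothesis.\<close>
    define \<kappa> where "\<kappa> = 6 / (2 + \<Delta> / \<epsilon>)"
    have d: "\<Delta> / \<epsilon> > 0" using \<Delta> eps by simp
    have \<kappa>0: "\<kappa> > 0" using d by (simp add: \<kappa>_def)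
    \<comment> \<open>Both terms of \<open>\<Delta>\<close> enter here:
      \<open>4 \<le> \<Delta>\<close> gives \<open>\<kappa> \<le> 3 / 2 * \<epsilon>\<close>, below
      \<open>1 / 4\<close>, and \<open>144 * q \<le> \<Delta>\<close> gives
      \<open>\<kappa> * q \<le> \<epsilon> / 24\<close>.\<close>
    have "\<kappa> * \<Delta> \<le> 6 * \<epsilon>" using d eps \<Delta> by (simp add: \<kappa>_def field_simps)
    moreover have "\<kappa> * 4 \<le> \<kappa> * \<Delta>" "\<kappa> * (144 * q) \<le> \<kappa> * \<Delta>"
      using \<Delta> \<kappa>0 by (auto intro: mult_left_mono)
    ultimately have \<kappa>1: "\<kappa> \<le> 1 / 4" "\<kappa> * q \<le> \<epsilon> / 24" using eps by linarith+
    obtain s1 where "regular_balls M X0 (3 powr (q + 1)) s1 \<epsilon> \<kappa>"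
      using regular_balls_exists[OF assms(1-3) eps \<kappa>0 \<kappa>1] by blast
    then interpret regular_balls M X0 T s1 \<epsilon> \<kappa> by (simp add: T_def)
    show "\<exists>s1::real. \<forall>(K::int) (L::nat) (U :: nat \<Rightarrow> 'a \<Rightarrow> 'a mball) (V :: nat \<Rightarrow> 'a \<Rightarrow> 'a mball).
       K = \<lceil>2 * log C (4 / \<epsilon>)\<rceil> \<longrightarrow>
       real L \<ge> 2 * log C (4 / \<epsilon>) \<longrightarrow>
       tower X0 (L + 1) U \<and> centered X0 (L + 1) U \<longrightarrow>
       tower X0 (L + 1) V \<and> centered X0 (L + 1) V \<longrightarrow>
       core (tower_balls X0 (L + 1) U) \<subseteq> X0 \<and> core (tower_balls X0 (L + 1) V) \<subseteq> X0 \<longrightarrow>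
       rad (tower_balls X0 (L + 1) U) \<ge> s1 \<and> rad (tower_balls X0 (L + 1) V) \<ge> s1 \<longrightarrow>
       (\<forall>x\<in>X0. (\<forall>i\<in>{1..L + 1}. ball_set (U i x) \<subseteq> ball_set (V i x)) \<and>
                (\<forall>i\<in>{1..L}. ball_set (V i x) \<subseteq> ball_set (U (i + 1) x))) \<longrightarrow>
       (\<forall>x\<in>X0. \<forall>i\<in>{1..L + 1}.
          ball_set (enlarge (U i x) (1 + \<Delta> / \<epsilon>)) \<subseteq> ball_set (V i x)) \<longrightarrow>
       (\<forall>B\<in>tower_balls X0 (L + 1) V.
          \<not> (\<exists>\<D>. \<D> \<subseteq> ball_set ` tower_balls X0 (L + 1) U \<and> disjoint \<D> \<and>
                 fills M (4 * \<epsilon>) \<D> (ball_set B))) \<longrightarrow>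
       emeasure M (\<Union>B\<in>tower_level X0 U 1. ball_set B)
         \<le> ennreal ((1 + \<epsilon> / 3 powr (q + 1)) powi (- \<lfloor>real L / real_of_int K\<rfloor>))
            * emeasure M (\<Union>B\<in>tower_level X0 V (L + 1). ball_set B)"
    proof (intro exI[of _ s1] allI impI)
      fix K :: int and L :: nat and U V :: "nat \<Rightarrow> 'a \<Rightarrow> 'a mball"
      assume K: "K = \<lceil>2 * log C (4 / \<epsilon>)\<rceil>"
        and towers: "tower X0 (L + 1) U \<and> centered X0 (L + 1) U"
          "tower X0 (L + 1) V \<and> centered X0 (L + 1) V"
        and radii: "rad (tower_balls X0 (L + 1) U) \<ge> s1 \<and> rad (tower_balls X0 (L + 1) V) \<ge> s1"
        and nest: "\<forall>x\<in>X0. (\<forall>i\<in>{1..L + 1}. ball_set (U i x) \<subseteq> ball_set (V i x)) \<and>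
                (\<forall>i\<in>{1..L}. ball_set (V i x) \<subseteq> ball_set (U (i + 1) x))"
        and enl: "\<forall>x\<in>X0. \<forall>i\<in>{1..L + 1}.
          ball_set (enlarge (U i x) (1 + \<Delta> / \<epsilon>)) \<subseteq> ball_set (V i x)"
        and unfill: "\<forall>B\<in>tower_balls X0 (L + 1) V.
          \<not> (\<exists>\<D>. \<D> \<subseteq> ball_set ` tower_balls X0 (L + 1) U \<and> disjoint \<D> \<and>
                 fills M (4 * \<epsilon>) \<D> (ball_set B))"
      have fin: "finite (ball_set ` A i ` X0)" if "tower X0 (L + 1) A" "i \<in> {1..L + 1}" for A i
      proof (rule finite_subset)
        show "ball_set ` A i ` X0 \<subseteq> ball_set ` tower_balls X0 (L + 1) A"
          unfolding tower_balls_def tower_level_def using that(2) by (intro image_mono) blast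
        show "finite (ball_set ` tower_balls X0 (L + 1) A)" using that(1) by (simp add: tower_def)
      qed
      interpret unfillable_towers M X0 T s1 \<epsilon> \<kappa> "L + 1" U V
      proof
        fix i x assume x: "x \<in> X0" and i: "i \<in> {1..L + 1}"
        show cU: "ball_center (U i x) = x" and "s1 \<le> ball_radius (U i x)"
          using centered_radius_bounds[of X0 "L + 1" U s1 x i] towers radii x i by auto
        show "ball_center (V i x) = x" "s1 \<le> ball_radius (V i x)"
          using centered_radius_bounds[of X0 "L + 1" V s1 x i] towers radii x i by auto
        show "ball_set (U i x) \<subseteq> ball_set (V i x)" using nest x i by blast
        have "6 / \<kappa> = 1 + (1 + \<Delta> / \<epsilon>)" using d by (simp add: \<kappa>_def)
        then have "cball x (6 / \<kappa> * ball_radius (U i x)) = ball_set (enlarge (U i x) (1 + \<Delta> / \<epsilon>))"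
          by (simp add: ball_set_def enlarge_def cU)
        then show "cball x (6 / \<kappa> * ball_radius (U i x)) \<subseteq> ball_set (V i x)"
          using enl x i by blast
      next
        fix i x assume "x \<in> X0" "i \<in> {1..<L + 1}"
        then show "ball_set (V i x) \<subseteq> ball_set (U (i + 1) x)" using nest by auto
      next
        fix i assume "i \<in> {1..L + 1}"
        then show "finite (ball_set ` U i ` X0)" "finite (ball_set ` V i ` X0)"
          using fin towers by auto
      next
        fix i x P
        assume x: "x \<in> X0" and i: "i \<in> {1..L + 1}" and P: "finite P"
          "P \<subseteq> (\<Union>j\<in>{1..L + 1}. U j ` X0)" "disjoint_family_on ball_set P"
          "(\<Union>B\<in>P. ball_set B) \<subseteq> ball_set (V i x)"
        define W where "W = ball_set (V i x)"
        define R where "R = W - (\<Union>B\<in>P. ball_set B)"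
        have W: "W \<in> fmeasurable M" by (simp add: W_def fmeas_ball)
        have R: "R \<in> fmeasurable M"
          unfolding R_def using W P(1) fmeas_ball
          by (intro fmeasurable.Diff fmeasurable.finite_UN) auto
        \<comment> \<open>Inclusion and measurability hold for \<open>P\<close>, so failure to fill
          can only come from the measure of the remainder.\<close>
        have "\<not> fills M (4 * \<epsilon>) (ball_set ` P) W"
        proof -
          have "V i x \<in> tower_balls X0 (L + 1) V"
            using x i by (auto simp: tower_balls_def tower_level_def)
          moreover have "ball_set ` P \<subseteq> ball_set ` tower_balls X0 (L + 1) U"
            using P(2) by (auto simp: tower_balls_def tower_level_def)
          moreover have "disjoint (ball_set ` P)"
            using P(3) by (rule disjoint_family_on_disjoint_image)
          ultimately show ?thesis using unfill unfolding W_def by blast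
        qed
        then have "ennreal (4 * \<epsilon>) * emeasure M W \<le> emeasure M R"
          using P(4) W fmeas_ball by (force simp: fills_def R_def W_def not_less intro: fmeasurableD)
        then have "4 * \<epsilon> * measure M W \<le> measure M R"
          using \<epsilon> by (simp add: emeasure_eq_measure2 W R ennreal_mult'[symmetric])
        then show "4 * \<epsilon> * measure M (ball_set (V i x))
            \<le> measure M (ball_set (V i x) - (\<Union>B\<in>P. ball_set B))"
          by (simp add: W_def R_def)
      qed
      have "C > 1" using T3 by (simp add: C)
      then have "0 < log C (4 / \<epsilon>)" using eps by simp
      then have "K \<ge> 1" using K by linarith
      \<comment> \<open>One of the \<open>K\<close> levels in a block serves to pass from
        \<open>V n\<close> to \<open>U (n + 1)\<close>, which leaves \<open>K - 1\<close> filling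
        steps.\<close>
      define k where "k = nat K - 1"
      have Kk: "K = int (k + 1)" using \<open>K \<ge> 1\<close> by (simp add: k_def)
      have "2 * log C (4 / \<epsilon>) \<le> real (k + 1)" using K Kk by linarith
      then have small: "(1 - 1 / T) ^ k < 4 * \<epsilon>"
        using C T3 eps by (intro remainder_power_bound[where C = C]) auto
      \<comment> \<open>\<open>j\<close> whole blocks of \<open>K\<close> levels, started at level
        1, end at level \<open>1 + j * K\<close>, which is at most the height
        \<open>L + 1\<close>.\<close>
      define j where "j = L div (k + 1)"
      have floor: "\<lfloor>real L / real_of_int K\<rfloor> = int j"
        unfolding Kk j_def by (metis floor_divide_of_nat_eq of_int_of_nat_eq)
      have jL: "1 + j * (k + 1) \<le> L + 1" using div_times_less_eq_dividend[of L "k + 1"] by (simp add: j_def)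
      define S where "S = (\<Union>x\<in>X0. ball_set (V (L + 1) x))"
      have mS: "S \<in> fmeasurable M"
        unfolding S_def using fmeas_UN_balls[of "V (L + 1) ` X0"] finite_V by simp
      have "level (1 + j * (k + 1)) \<subseteq> S"
        using U_mono[of _ "1 + j * (k + 1)" "L + 1"] U_sub_V[of _ "L + 1"] jL
        by (fastforce simp: S_def)
      then have "measure M (level (1 + j * (k + 1))) \<le> measure M S"
        using fmeas_level[of "1 + j * (k + 1)"] jL mS
        by (intro measure_mono_fmeasurable) (auto intro: fmeasurableD)
      then have "(1 + \<epsilon> / T) ^ j * measure M (level 1) \<le> measure M S"
        using iterated_level_growth[OF small jL] by linarith
      moreover have pos: "0 < (1 + \<epsilon> / T) ^ j" using \<epsilon> T by (intro zero_less_power add_pos_pos) auto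
      ultimately have "measure M (level 1) \<le> inverse ((1 + \<epsilon> / T) ^ j) * measure M S"
        by (simp add: field_simps)
      then have "emeasure M (level 1) \<le> ennreal (inverse ((1 + \<epsilon> / T) ^ j)) * emeasure M S"
        using fmeas_level[of 1] mS pos
        by (simp add: emeasure_eq_measure2 ennreal_mult'[symmetric] ennreal_leI)
      then show "emeasure M (\<Union>B\<in>tower_level X0 U 1. ball_set B)
         \<le> ennreal ((1 + \<epsilon> / 3 powr (q + 1)) powi (- \<lfloor>real L / real_of_int K\<rfloor>))
            * emeasure M (\<Union>B\<in>tower_level X0 V (L + 1). ball_set B)"
        unfolding floor T_def[symmetric] by (simp add: tower_level_def power_int_minus S_def)
    qed
  qed
qed

end
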